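(* For integers $j\ge1$ let $x_j=-\frac{1}{\log 2}W_{-1}(-(\log2)\,10^{-j})$, i.e. the larger real root of $2^{x}=x\,10^j$, and let $m_j=\lceil x_j\rceil$. Then $$m_1=6,\qquad m_2=10,\qquad m_{j+1}-m_j\in\{3,4\}\quad(j\ge1).$$ If $G_4(N)=\#\{1\le j<N:m_{j+1}-m_j=4\}$, then $$G_4(N)=m_N-3N-3=(\log_2 10-3)N+\log_2N+O(1).$$ For every integer $M\ge2$, $$\#\{j\ge1:m_j\le M\}=\left\lfloor M\log_{10}2-\log_{10}M\right\rfloor.$$
   Context: $\log$ is the natural logarithm. $W_{-1}$ is the real branch of the Lambert $W$ function (inverse of $w\mapsto we^w$) on $[-e^{-1},0)$ with values in $(-\infty,-1]$. The integers $m_j$ are only possible candidates for the property that $2^m$ begins with $m$ in decimal; the statements count candidates, not actual solutions. *)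

theory Defs
  imports Complex_Main "HOL-Library.Landau_Symbols"
begin

(* Unspecified outside [-exp (-1), 0). *)
definition Lambert_Wm1 :: "real \<Rightarrow> real" where
  "Lambert_Wm1 t = (THE w. w \<le> -1 \<and> w * exp w = t)"

definition x_cand :: "nat \<Rightarrow> real" where
  "x_cand j = - (1 / ln 2) * Lambert_Wm1 (- ln 2 * 10 powr (- real j))"

definition m_cand :: "nat \<Rightarrow> int" where
  "m_cand j = \<lceil>x_cand j\<rceil>"

definition G4 :: "nat \<Rightarrow> nat" where
  "G4 N = card {j. 1 \<le> j \<and> j < N \<and> m_cand (j + 1) - m_cand j = 4}"

end

theory Submission
  imports Defs
begin

text \<open>
  For an integer \<open>n \<ge> 2\<close> and \<open>j \<ge> 1\<close>, the inequality \<open>m_cand j \<le> n\<close> holds iff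
  \<open>n * 10 ^ j \<le> 2 ^ n\<close> (lemma \<open>m_cand_le_iff\<close>): beyond \<open>1 / ln 2\<close>, which lies below \<open>2\<close>,
  the function \<open>2 powr x / x\<close> is increasing, and \<open>x_cand j\<close> is the point there at which it takes
  the value \<open>10 ^ j\<close>. The substitution \<open>w = - x * ln 2\<close> turns this into the monotonicity of
  \<open>w * exp w\<close> on either side of \<open>-1\<close>, which also gives the two real roots.

  Thus \<open>m_cand j\<close> is the least \<open>n \<ge> 2\<close> with \<open>n * 10 ^ j \<le> 2 ^ n\<close>, and all that remains
  concerns this integer inequality. Raising the largest failing \<open>n\<close> by \<open>3\<close> multiplies the
  right-hand side by \<open>8\<close> only, which does not make up for a further factor \<open>10\<close> on the left, so
  every gap is at least \<open>3\<close>. Raising the least satisfying \<open>n\<close> by \<open>4\<close> multiplies it by \<open>16\<close>,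
  which suffices once \<open>16 * n \<ge> 10 * (n + 4)\<close>, that is, for \<open>n \<ge> 7\<close>; the one smaller value is
  \<open>m_cand 1 = 6\<close>, where the next candidate is \<open>10\<close>. So all gaps are \<open>3\<close> or \<open>4\<close>, and summing them
  expresses \<open>G4 N\<close> by \<open>m_cand N\<close>. Taking logarithms to base \<open>2\<close> at \<open>n = m_cand N\<close>, where the
  inequality holds, and at \<open>n - 1\<close>, where it fails, gives \<open>m_cand N\<close> up to a bounded error as
  \<open>N * log 2 10 + log 2 (m_cand N)\<close>; inside the logarithm \<open>N\<close> may replace \<open>m_cand N\<close>, because the gap
  bounds make their ratio bounded. Taking logarithms to base \<open>10\<close> and solving for \<open>j\<close> instead
  gives the exact count of the candidates up to \<open>M\<close>.
\<close>

section \<open>The lower real branch of the Lambert function\<close>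

lemma DERIV_times_exp: "((\<lambda>w. w * exp w) has_real_derivative (1 + w) * exp w) (at w)"
  by (auto intro!: derivative_eq_intros simp: algebra_simps)

lemma times_exp_decreasing:
  fixes a b :: real
  assumes "a < b" "b \<le> -1"
  shows "b * exp b < a * exp a"
proof (rule DERIV_neg_imp_decreasing_open[OF \<open>a < b\<close>])
  show "\<exists>y. ((\<lambda>w. w * exp w) has_real_derivative y) (at x) \<and> y < 0"
    if "a < x" "x < b" for x
    using DERIV_times_exp[of x] that assms by (auto intro!: exI simp: mult_less_0_iff)
qed (intro continuous_intros)

lemma times_exp_increasing:
  fixes a b :: real
  assumes "a < b" "-1 \<le> a"
  shows "a * exp a < b * exp b"
proof (rule DERIV_pos_imp_increasing_open[OF \<open>a < b\<close>])
  show "\<exists>y. ((\<lambda>w. w * exp w) has_real_derivative y) (at x) \<and> y > 0"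
    if "a < x" "x < b" for x
    using DERIV_times_exp[of x] that assms by (auto intro!: exI)
qed (intro continuous_intros)

text \<open>
  On the unbounded interval below \<open>-1\<close> the intermediate value theorem needs a point where
  \<open>w * exp w\<close> exceeds \<open>t\<close>. The quadratic Taylor bound makes \<open>u * exp (-u)\<close> less than \<open>2 / u\<close>,
  so \<open>w = 2 / t\<close> is far enough to the left.
\<close>

lemma ex_lower_root:
  fixes t :: real
  assumes "-exp (-1) < t" "t < 0"
  shows "\<exists>w < -1. w * exp w = t"
proof -
  define u where "u = - 2 / t"
  have "exp (-1::real) < 1" by simp
  with assms have "-1 < t" by linarith
  with assms have u: "2 < u"
    unfolding u_def by (simp add: field_simps)
  have "u\<^sup>2 / 2 < exp u"
    using exp_lower_Taylor_quadratic[of u] u by simp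
  then have "u * exp (-u) < 2 / u"
    using u by (simp add: exp_minus field_simps power2_eq_square)
  also have "2 / u = -t"
    using assms by (simp add: u_def)
  finally have "t \<le> (-u) * exp (-u)" by simp
  moreover have "(-1) * exp (-1) \<le> t" using assms by simp
  moreover have "continuous_on {-u..-1} (\<lambda>w::real. w * exp w)" by (intro continuous_intros)
  ultimately obtain w where "w \<le> -1" "w * exp w = t"
    using IVT2'[of "\<lambda>w. w * exp w" "-1" t "-u"] u by auto
  moreover from this have "w \<noteq> -1" using assms by auto
  ultimately show ?thesis by force
qed

lemma Lambert_Wm1_root:
  assumes "-exp (-1) < t" "t < 0"
  shows "Lambert_Wm1 t < -1" "Lambert_Wm1 t * exp (Lambert_Wm1 t) = t"
proof -
  obtain w where w: "w < -1" "w * exp w = t"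
    using ex_lower_root[OF assms] by blast
  have "Lambert_Wm1 t = w"
    unfolding Lambert_Wm1_def
  proof (rule the_equality)
    show "w \<le> -1 \<and> w * exp w = t" using w by simp
    show "v = w" if "v \<le> -1 \<and> v * exp v = t" for v
      using times_exp_decreasing[of v w] times_exp_decreasing[of w v] w that by force
  qed
  with w show "Lambert_Wm1 t < -1" "Lambert_Wm1 t * exp (Lambert_Wm1 t) = t" by auto
qed

lemma times_exp_roots:
  fixes t :: real
  assumes "-exp (-1) < t" "t < 0"
  shows "\<exists>v > -1. {w. w * exp w = t} = {v, Lambert_Wm1 t}"
proof -
  have "continuous_on {-1..0} (\<lambda>w::real. w * exp w)" by (intro continuous_intros)
  then obtain v where v: "-1 \<le> v" "v * exp v = t"
    using IVT'[of "\<lambda>w. w * exp w" "-1" t 0] assms by auto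
  have "v \<noteq> -1" using v assms by auto
  moreover have "w = v \<or> w = Lambert_Wm1 t" if "w * exp w = t" for w
  proof (cases "w \<le> -1")
    case True
    then show ?thesis
      using times_exp_decreasing[of w "Lambert_Wm1 t"] times_exp_decreasing[of "Lambert_Wm1 t" w]
        Lambert_Wm1_root[OF assms] that by force
  next
    case False
    then show ?thesis
      using times_exp_increasing[of w v] times_exp_increasing[of v w] v that by force
  qed
  ultimately show ?thesis
    using v Lambert_Wm1_root(2)[OF assms] by (intro exI[of _ v]) auto
qed

section \<open>The root as a threshold for an integer inequality\<close>

lemma two_powr_eq_iff_times_exp:
  "2 powr x = x * 10 ^ j \<longleftrightarrow> (- x * ln 2) * exp (- x * ln 2) = - ln 2 * 10 powr (- real j)"
  by (auto simp: powr_def[of 2] powr_minus powr_realpow exp_minus field_simps)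

lemma Lambert_argument_bounds:
  assumes "1 \<le> j"
  shows "- exp (-1) < - ln 2 * 10 powr (- real j)" "- ln 2 * 10 powr (- real j) < 0"
proof -
  have "10 powr (- real j) \<le> 10 powr (-1)"
    using assms by (intro powr_mono) auto
  moreover have "ln 2 < (1::real)" by (rule ln_2_less_1)
  ultimately have "ln 2 * 10 powr (- real j) \<le> 1 * (1 / 10)"
    by (intro mult_mono) (auto simp: powr_minus)
  moreover have "1 / 3 \<le> exp (-1::real)"
    using exp_le by (simp add: exp_minus field_simps)
  ultimately show "- exp (-1) < - ln 2 * 10 powr (- real j)" by simp
qed simp

lemma x_cand_larger_root:
  assumes "1 \<le> j"
  shows "\<exists>y. y < x_cand j \<and> {x. 2 powr x = x * 10 ^ j} = {y, x_cand j}"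
proof -
  define t where "t = - ln 2 * 10 powr (- real j)"
  have t: "- exp (-1) < t" "t < 0"
    using Lambert_argument_bounds[OF assms] by (simp_all add: t_def)
  obtain v where v: "-1 < v" "{w. w * exp w = t} = {v, Lambert_Wm1 t}"
    using times_exp_roots[OF t] by blast
  have x: "x_cand j = - Lambert_Wm1 t / ln 2"
    by (simp add: x_cand_def t_def)
  have "2 powr x = x * 10 ^ j \<longleftrightarrow> x \<in> {- v / ln 2, x_cand j}" for x
  proof -
    have "2 powr x = x * 10 ^ j \<longleftrightarrow> - x * ln 2 \<in> {w. w * exp w = t}"
      by (simp only: two_powr_eq_iff_times_exp t_def mem_Collect_eq)
    also have "\<dots> \<longleftrightarrow> x \<in> {- v / ln 2, x_cand j}"
      unfolding v(2) x by (auto simp: field_simps)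
    finally show ?thesis .
  qed
  moreover have "- v / ln 2 < x_cand j"
    unfolding x using v(1) Lambert_Wm1_root(1)[OF t] by (intro divide_strict_right_mono) auto
  ultimately show ?thesis by blast
qed

text \<open>
  The bound \<open>2 \<le> n\<close> ensures \<open>- n * ln 2 \<le> -1\<close>, so that this point lies on the same decreasing
  branch of \<open>w * exp w\<close> as the Lambert value and comparing arguments amounts to comparing values.
\<close>

lemma m_cand_le_iff:
  assumes "1 \<le> j" "2 \<le> n"
  shows "m_cand j \<le> int n \<longleftrightarrow> n * 10 ^ j \<le> 2 ^ n"
proof -
  define t where "t = - ln 2 * 10 powr (- real j)"
  have t: "- exp (-1) < t" "t < 0"
    using Lambert_argument_bounds[OF assms(1)] by (simp_all add: t_def)
  define w where "w = Lambert_Wm1 t"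
  have w: "w < -1" "w * exp w = t"
    using Lambert_Wm1_root[OF t] by (simp_all add: w_def)
  define a where "a = - real n * ln 2"
  have "1 / 2 \<le> ln (2::real)" using ln_le_minus_one[of "1 / 2"] by (simp add: ln_div)
  then have "2 * (1 / 2) \<le> real n * ln 2"
    using assms(2) by (intro mult_mono) auto
  then have a: "a \<le> -1" by (simp add: a_def)
  have "m_cand j \<le> int n \<longleftrightarrow> x_cand j \<le> real n"
    by (simp add: m_cand_def ceiling_le_iff)
  also have "\<dots> \<longleftrightarrow> a \<le> w"
    by (simp add: x_cand_def a_def w_def t_def field_simps minus_le_iff)
  also have "\<dots> \<longleftrightarrow> t \<le> a * exp a"
    using times_exp_decreasing[of a w] times_exp_decreasing[of w a] w a
    by (cases a w rule: linorder_cases) auto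
  also have "\<dots> \<longleftrightarrow> real n * 10 ^ j \<le> 2 powr n"
    by (auto simp: t_def a_def powr_def[of 2] powr_minus powr_realpow exp_minus field_simps)
  also have "\<dots> \<longleftrightarrow> real (n * 10 ^ j) \<le> real (2 ^ n)"
    by (simp add: powr_realpow)
  also have "\<dots> \<longleftrightarrow> n * 10 ^ j \<le> 2 ^ n"
    by (rule of_nat_le_iff)
  finally show ?thesis .
qed


section \<open>Consecutive candidates\<close>

text \<open>
  Being the threshold, \<open>m_cand j\<close> satisfies the integer inequality while its predecessor violates
  it. No candidate is below \<open>6\<close>, because \<open>5 * 10 ^ j\<close> is at least \<open>50\<close>, which exceeds \<open>2 ^ 5\<close>.
\<close>

lemma m_cand_natE:
  assumes "1 \<le> j"
  obtains n where "m_cand j = int n" "6 \<le> n" "n * 10 ^ j \<le> 2 ^ n" "2 ^ (n - 1) < (n - 1) * 10 ^ j"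
proof -
  have "(10::nat) ^ 1 \<le> 10 ^ j"
    using assms by (intro power_increasing) auto
  then have "\<not> m_cand j \<le> int 5"
    using m_cand_le_iff[OF assms, of 5] by simp
  then obtain n where n: "m_cand j = int n" "6 \<le> n"
    by (intro that[of "nat (m_cand j)"]) auto
  moreover have "n * 10 ^ j \<le> 2 ^ n"
    using m_cand_le_iff[OF assms, of n] n by simp
  moreover have "2 ^ (n - 1) < (n - 1) * 10 ^ j"
    using m_cand_le_iff[OF assms, of "n - 1"] n by (simp add: not_le)
  ultimately show thesis by (rule that)
qed

lemma m_cand_1: "m_cand 1 = 6"
  using m_cand_le_iff[of 1 5] m_cand_le_iff[of 1 6] by simp

lemma m_cand_2: "m_cand 2 = 10"
  using m_cand_le_iff[of 2 9] m_cand_le_iff[of 2 10] by simp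

lemma m_cand_step:
  assumes "1 \<le> j"
  shows "m_cand (j + 1) - m_cand j \<in> {3, 4}"
proof -
  obtain n where n: "m_cand j = int n" "6 \<le> n" "n * 10 ^ j \<le> 2 ^ n" "2 ^ (n - 1) < (n - 1) * 10 ^ j"
    using m_cand_natE[OF assms] .
  obtain k where k: "n = k + 1" using n(2) by (cases n) auto
  have "(2::nat) ^ (n + 2) = 8 * 2 ^ k" by (simp add: k power_add)
  also have "\<dots> < 8 * (k * 10 ^ j)" using n(4) by (simp add: k)
  also have "\<dots> \<le> (n + 2) * 10 ^ (j + 1)" by (simp add: k algebra_simps)
  finally have "\<not> m_cand (j + 1) \<le> int (n + 2)"
    using m_cand_le_iff[of "j + 1" "n + 2"] by simp
  moreover have "m_cand (j + 1) \<le> int (n + 4)"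
  proof (cases "n = 6")
    case True
    \<comment> \<open>The factor \<open>16\<close> falls short at \<open>n = 6\<close>, but \<open>6 * 10 ^ j \<le> 64\<close> leaves only \<open>j = 1\<close>.\<close>
    then have "(10::nat) ^ j < 10 ^ 2" using n(3) by simp
    then have "j = 1" using assms by (subst (asm) power_strict_increasing_iff) auto
    moreover have "m_cand (1 + 1) = 10"
      using m_cand_2 by (simp add: numeral_2_eq_2)
    ultimately show ?thesis using True by simp
  next
    case False
    have "(n + 4) * 10 ^ (j + 1) = (10 * n + 40) * 10 ^ j" by (simp add: algebra_simps)
    also have "\<dots> \<le> (16 * n) * 10 ^ j"
      using False n(2) by (intro mult_right_mono) auto
    also have "\<dots> \<le> 16 * 2 ^ n" using n(3) by simp
    also have "\<dots> = 2 ^ (n + 4)" by (simp add: power_add)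
    finally show ?thesis using m_cand_le_iff[of "j + 1" "n + 4"] n(2) by simp
  qed
  ultimately show ?thesis using n(1) by auto
qed

section \<open>Counting\<close>

text \<open>
  The gaps up to \<open>N\<close> telescope from \<open>m_cand 1 = 6\<close>; each contributes \<open>3\<close>, and one more exactly
  when it is counted by \<open>G4\<close>.
\<close>

lemma G4_eq:
  assumes "1 \<le> N"
  shows "int (G4 N) = m_cand N - 3 * int N - 3"
  using assms
proof (induction N rule: dec_induct)
  case base
  have "G4 1 = 0" by (simp add: G4_def)
  then show ?case using m_cand_1 by simp
next
  case (step N)
  let ?S = "\<lambda>N. {j. 1 \<le> j \<and> j < N \<and> m_cand (j + 1) - m_cand j = 4}"
  show ?case
  proof (cases "m_cand (N + 1) - m_cand N = 4")
    case True
    have "?S (Suc N) = insert N (?S N)"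
      using True step.hyps by (auto simp: less_Suc_eq)
    then have "G4 (Suc N) = G4 N + 1" by (simp add: G4_def)
    then show ?thesis using step.IH True by simp
  next
    case False
    have "?S (Suc N) = ?S N"
      using False by (auto simp: less_Suc_eq)
    then have "G4 (Suc N) = G4 N" by (simp add: G4_def)
    then show ?thesis using step False m_cand_step[of N] by simp
  qed
qed

lemma m_cand_bounds:
  assumes "1 \<le> N"
  shows "3 * int N + 3 \<le> m_cand N" "m_cand N \<le> 4 * int N + 2"
proof -
  show "3 * int N + 3 \<le> m_cand N" using G4_eq[OF assms] by linarith
  have "G4 N \<le> card {1..<N}" unfolding G4_def by (intro card_mono) auto
  then show "m_cand N \<le> 4 * int N + 2" using G4_eq[OF assms] assms by simp
qed

text \<open>
  The error \<open>4\<close> is \<open>1\<close> from passing to the predecessor of \<open>m_cand N\<close> and \<open>3\<close> from replacing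
  \<open>log 2 (m_cand N)\<close> by \<open>log 2 N\<close>, as \<open>m_cand N\<close> lies between \<open>N\<close> and \<open>2 ^ 3 * N\<close>.
\<close>

lemma m_cand_asymptotic:
  assumes "1 \<le> N"
  shows "\<bar>real_of_int (m_cand N) - (log 2 10 * real N + log 2 (real N))\<bar> \<le> 4"
proof -
  obtain n where n: "m_cand N = int n" "6 \<le> n" "n * 10 ^ N \<le> 2 ^ n" "2 ^ (n - 1) < (n - 1) * 10 ^ N"
    using m_cand_natE[OF assms] .
  have bounds: "N \<le> n" "n \<le> 8 * N"
    using m_cand_bounds[OF assms] n(1) assms by auto
  have "real (n * 10 ^ N) \<le> real (2 ^ n)"
    using n(3) by (simp only: of_nat_le_iff)
  then have "log 2 (real n * 10 ^ N) \<le> log 2 (2 ^ n)"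
    using n(2) by (subst log_le_cancel_iff) auto
  then have "log 2 n + N * log 2 10 \<le> n"
    using n(2) by (simp add: log_mult log_nat_power)
  moreover have "log 2 N \<le> log 2 n"
    using bounds assms by simp
  moreover have "real n \<le> 1 + log 2 n + N * log 2 10"
  proof -
    have "real (2 ^ (n - 1)) < real ((n - 1) * 10 ^ N)"
      using n(4) by (simp only: of_nat_less_iff)
    also have "\<dots> \<le> real n * 10 ^ N" using n(2) by simp
    finally have "log 2 (2 ^ (n - 1)) \<le> log 2 (real n * 10 ^ N)"
      using n(2) by (subst log_le_cancel_iff) auto
    then show ?thesis
      using n(2) by (simp add: log_mult log_nat_power)
  qed
  moreover have "log 2 n \<le> 3 + log 2 N"
  proof -
    have "log 2 (real n) \<le> log 2 (2 ^ 3 * real N)"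
      using bounds n(2) by (subst log_le_cancel_iff) auto
    also have "\<dots> = 3 + log 2 N"
      using assms log_nat_power[of 2 2 3] by (subst log_mult) auto
    finally show ?thesis .
  qed
  ultimately show ?thesis using n(1) by (simp add: mult.commute abs_le_iff)
qed

lemma G4_asymptotic:
  "(\<lambda>N. real (G4 N) - ((log 2 10 - 3) * real N + log 2 (real N))) \<in> O(\<lambda>N. 1)"
proof (rule bigoI[of _ 7])
  show "\<forall>\<^sub>F N in sequentially. norm (real (G4 N) - ((log 2 10 - 3) * real N + log 2 (real N))) \<le> 7 * norm (1::real)"
    using eventually_ge_at_top[of 1]
  proof eventually_elim
    case (elim N)
    have "real (G4 N) = real_of_int (int (G4 N))" by simp
    also have "\<dots> = real_of_int (m_cand N) - 3 * real N - 3"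
      unfolding G4_eq[OF elim] by simp
    finally show ?case
      using m_cand_asymptotic[OF elim] by (simp add: algebra_simps abs_le_iff)
  qed
qed

text \<open>
  The indices of the candidates up to \<open>M\<close> form an initial segment, since the logarithm to base
  \<open>10\<close> makes the integer inequality linear in \<open>j\<close>. Its end \<open>F\<close> is nonnegative because the
  inequality also holds at \<open>j = 0\<close>, where it reads \<open>n \<le> 2 ^ n\<close>; hence \<open>nat\<close> truncates nothing.
\<close>

lemma candidates_upto:
  fixes M :: int
  assumes "2 \<le> M"
  defines "F \<equiv> \<lfloor>M * log 10 2 - log 10 M\<rfloor>"
  shows "{j. 1 \<le> j \<and> m_cand j \<le> M} = {1..nat F}" "0 \<le> F"
proof -
  obtain n where n: "M = int n" "2 \<le> n"
    using assms(1) by (intro that[of "nat M"]) auto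
  have iff: "n * 10 ^ j \<le> 2 ^ n \<longleftrightarrow> int j \<le> F" for j
  proof -
    have "n * 10 ^ j \<le> 2 ^ n \<longleftrightarrow> real (n * 10 ^ j) \<le> real (2 ^ n)"
      by (simp only: of_nat_le_iff)
    also have "\<dots> \<longleftrightarrow> log 10 (real n * 10 ^ j) \<le> log 10 (2 ^ n)"
      using n(2) by (subst log_le_cancel_iff) auto
    also have "\<dots> \<longleftrightarrow> real j \<le> n * log 10 2 - log 10 n"
      using n(2) by (auto simp: log_mult log_nat_power)
    also have "\<dots> \<longleftrightarrow> int j \<le> F"
      by (simp add: F_def n(1) le_floor_iff)
    finally show ?thesis .
  qed
  show "0 \<le> F"
    using iff[of 0] less_exp[of n] by simp
  show "{j. 1 \<le> j \<and> m_cand j \<le> M} = {1..nat F}"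
    using m_cand_le_iff[of _ n] n iff by (auto simp: le_nat_iff[OF \<open>0 \<le> F\<close>])
qed

theorem corollary3p6:
  shows "(\<forall>j\<ge>1. \<exists>y. y < x_cand j \<and> {x::real. 2 powr x = x * 10 ^ j} = {y, x_cand j})
    \<and> m_cand 1 = 6 \<and> m_cand 2 = 10
    \<and> (\<forall>j\<ge>1. m_cand (j + 1) - m_cand j \<in> {3, 4})
    \<and> (\<forall>N\<ge>1. int (G4 N) = m_cand N - 3 * int N - 3)
    \<and> (\<lambda>N. real (G4 N) - ((log 2 10 - 3) * real N + log 2 (real N))) \<in> O(\<lambda>N. 1)
    \<and> (\<forall>M::int. M \<ge> 2 \<longrightarrow>
         finite {j::nat. 1 \<le> j \<and> m_cand j \<le> M} \<and>
         int (card {j::nat. 1 \<le> j \<and> m_cand j \<le> M})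
           = \<lfloor>real_of_int M * log 10 2 - log 10 (real_of_int M)\<rfloor>)"
  using x_cand_larger_root m_cand_1 m_cand_2 m_cand_step G4_eq G4_asymptotic
  by (intro conjI allI impI) (simp_all only: candidates_upto finite_atLeastAtMost card_atLeastAtMost diff_Suc_1 nat_0_le)

end
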